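(* Let $\mathfrak g$ be an $n$-Lie algebra, $E$ a vector space containing $\mathfrak g$, and $[-,\dots,-]_E$ an $n$-Lie bracket on $E$ whose restriction to $\mathfrak g$ is the given bracket. Choose a linear projection $p:E\to\mathfrak g$ with $p(x)=x$ for $x\in\mathfrak g$, and put $V=\ker p$, $q=\mathrm{id}_E-p$, so that $E=\mathfrak g\oplus V$. For $1\le k\le n$ define $$\Gamma_k^{\mathfrak g}(u_1,\dots,u_k;x_{k+1},\dots,x_n)=p([u_1,\dots,u_k,x_{k+1},\dots,x_n]_E),\qquad\Gamma_k^V(u_1,\dots,u_k;x_{k+1},\dots,x_n)=q([u_1,\dots,u_k,x_{k+1},\dots,x_n]_E).$$ Then these maps form a full extending structure $\boldsymbol\Gamma$ of $\mathfrak g$ through $V$. The linear map $\Phi:\mathfrak g\natural^{\mathrm{full}}_{\boldsymbol\Gamma}V\to E$, $\Phi(x+u)=x+u$, is an $n$-Lie algebra isomorphism fixing $\mathfrak g$ pointwise and inducing the identity on $E/\mathfrak g\cong V$. Conversely, every full unified product $\mathfrak g\natural^{\mathrm{full}}_{\boldsymbol\Gamma}V$ is an extending structure of $\mathfrak g$ on $\mathfrak g\oplus V$, i.e. an $n$-Lie bracket on $\mathfrak g\oplus V$ restricting to the given bracket of $\mathfrak g$.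
   Context: $K$ is a field of characteristic zero; vector spaces are over $K$, all maps are linear; $n\ge2$. An $n$-Lie algebra is a vector space with an alternating $n$-linear bracket satisfying the Filippov identity $[z_1,\dots,z_{n-1},[w_1,\dots,w_n]]=\sum_{i=1}^n[w_1,\dots,w_{i-1},[z_1,\dots,z_{n-1},w_i],w_{i+1},\dots,w_n]$. A full extending datum of $\mathfrak g$ through $V$ is a family $\boldsymbol\Gamma=((\Gamma_k^{\mathfrak g},\Gamma_k^V))_{1\le k\le n}$ of linear maps $\Gamma_k^{\mathfrak g}:\bigwedge^kV\otimes\bigwedge^{n-k}\mathfrak g\to\mathfrak g$ and $\Gamma_k^V:\bigwedge^kV\otimes\bigwedge^{n-k}\mathfrak g\to V$, together with the convention $\Gamma_0^{\mathfrak g}(x_1,\dots,x_n)=[x_1,\dots,x_n]_{\mathfrak g}$, $\Gamma_0^V=0$. It defines the alternating multilinear operation on $\mathfrak g\oplus V$ $$[x_1+u_1,\dots,x_n+u_n]_{\boldsymbol\Gamma}=\sum_{k=0}^n\ \sum_{1\le i_1<\dots<i_k\le n}(-1)^{i_1+\dots+i_k-k(k+1)/2}\,(\Gamma_k^{\mathfrak g}+\Gamma_k^V)(u_{i_1},\dots,u_{i_k};x_{j_1},\dots,x_{j_{n-k}}),$$ where $j_1<\dots<j_{n-k}$ are the complementary indices in $\{1,\dots,n\}$ and the sum of the two values is taken in $\mathfrak g\oplus V$. If this operation satisfies the Filippov identity, $\boldsymbol\Gamma$ is called a full extending structure and the resulting $n$-Lie algebra is the full unified product $\mathfrak g\natural^{\mathrm{full}}_{\boldsymbol\Gamma}V$.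 *)

theory Defs
  imports "HOL-Analysis.Product_Vector" "HOL-Library.NList" "HOL-Library.Set_Algebras"
begin

text \<open>Vector spaces are subspaces (possibly \<^term>\<open>UNIV\<close>) of a type carrying a
  \<^locale>\<open>vector_space\<close> structure, given by its scalar multiplication. Maps and brackets are
  constrained on these carriers only. The arguments of an \<open>m\<close>-ary map form a list of length \<open>m\<close>.\<close>

definition linear_on ::
  "('k \<Rightarrow> 'a \<Rightarrow> 'a) \<Rightarrow> ('k \<Rightarrow> 'b \<Rightarrow> 'b) \<Rightarrow> 'a::ab_group_add set \<Rightarrow> ('a \<Rightarrow> 'b::ab_group_add) \<Rightarrow> bool"
  where "linear_on s t S f \<longleftrightarrow>
    (\<forall>x\<in>S. \<forall>y\<in>S. f (x + y) = f x + f y) \<and> (\<forall>c. \<forall>x\<in>S. f (s c x) = t c (f x))"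

definition multilinear_on ::
  "('k \<Rightarrow> 'a \<Rightarrow> 'a) \<Rightarrow> ('k \<Rightarrow> 'b \<Rightarrow> 'b) \<Rightarrow> 'a::ab_group_add set \<Rightarrow> nat \<Rightarrow> ('a list \<Rightarrow> 'b::ab_group_add) \<Rightarrow> bool"
  where "multilinear_on s t S m f \<longleftrightarrow>
    (\<forall>xs\<in>nlists m S. \<forall>i<m. linear_on s t S (\<lambda>y. f (xs[i := y])))"

definition alternating_on :: "'a set \<Rightarrow> nat \<Rightarrow> ('a list \<Rightarrow> 'b::zero) \<Rightarrow> bool"
  where "alternating_on S m f \<longleftrightarrow> (\<forall>xs\<in>nlists m S. \<not> distinct xs \<longrightarrow> f xs = 0)"

text \<open>Linear maps from the \<open>m\<close>-th exterior power of \<open>S\<close> to \<open>T\<close>.\<close>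

definition alternating_map ::
  "('k \<Rightarrow> 'a \<Rightarrow> 'a) \<Rightarrow> 'a::ab_group_add set \<Rightarrow> ('k \<Rightarrow> 'b \<Rightarrow> 'b) \<Rightarrow> 'b::ab_group_add set \<Rightarrow> nat \<Rightarrow> ('a list \<Rightarrow> 'b) \<Rightarrow> bool"
  where "alternating_map s S t T m f \<longleftrightarrow>
    (\<forall>xs\<in>nlists m S. f xs \<in> T) \<and> multilinear_on s t S m f \<and> alternating_on S m f"

definition filippov_identity :: "'a set \<Rightarrow> nat \<Rightarrow> ('a::ab_group_add list \<Rightarrow> 'a) \<Rightarrow> bool"
  where "filippov_identity S n br \<longleftrightarrow>
    (\<forall>zs\<in>nlists (n - 1) S. \<forall>ws\<in>nlists n S.
      br (zs @ [br ws]) = (\<Sum>i<n. br (ws[i := br (zs @ [ws ! i])])))"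

definition n_lie_algebra ::
  "('k::field \<Rightarrow> 'a \<Rightarrow> 'a) \<Rightarrow> nat \<Rightarrow> 'a::ab_group_add set \<Rightarrow> ('a list \<Rightarrow> 'a) \<Rightarrow> bool"
  where "n_lie_algebra s n S br \<longleftrightarrow>
    module.subspace s S \<and> alternating_map s S s S n br \<and> filippov_identity S n br"

definition n_lie_iso ::
  "('k::field \<Rightarrow> 'a \<Rightarrow> 'a) \<Rightarrow> ('k \<Rightarrow> 'b \<Rightarrow> 'b) \<Rightarrow> nat \<Rightarrow> 'a::ab_group_add set \<Rightarrow> ('a list \<Rightarrow> 'a) \<Rightarrow>
    'b::ab_group_add set \<Rightarrow> ('b list \<Rightarrow> 'b) \<Rightarrow> ('a \<Rightarrow> 'b) \<Rightarrow> bool"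
  where "n_lie_iso s t n S br T br' f \<longleftrightarrow>
    n_lie_algebra s n S br \<and> n_lie_algebra t n T br' \<and>
    linear_on s t S f \<and> bij_betw f S T \<and>
    (\<forall>xs\<in>nlists n S. f (br xs) = br' (map f xs))"

text \<open>Linear maps from (\<open>k\<close>-th exterior power of \<open>V\<close>) \<open>\<otimes>\<close> (\<open>m\<close>-th exterior power of \<open>S\<close>) to \<open>W\<close>,
  through the universal properties of the tensor product and of the exterior powers.\<close>

definition bi_alternating_map ::
  "('k \<Rightarrow> 'v \<Rightarrow> 'v) \<Rightarrow> 'v::ab_group_add set \<Rightarrow> nat \<Rightarrow> ('k \<Rightarrow> 'a \<Rightarrow> 'a) \<Rightarrow> 'a::ab_group_add set \<Rightarrow> nat \<Rightarrow>
    ('k \<Rightarrow> 'w \<Rightarrow> 'w) \<Rightarrow> 'w::ab_group_add set \<Rightarrow> ('v list \<Rightarrow> 'a list \<Rightarrow> 'w) \<Rightarrow> bool"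
  where "bi_alternating_map t V k s S m r W f \<longleftrightarrow>
    (\<forall>us\<in>nlists k V. alternating_map s S r W m (f us)) \<and>
    (\<forall>xs\<in>nlists m S. alternating_map t V r W k (\<lambda>us. f us xs))"

text \<open>\<open>\<Gamma>g k us xs\<close> and \<open>\<Gamma>V k us xs\<close> are the two components of the datum; only the indices
  \<open>1 \<le> k \<le> n\<close> matter.\<close>

definition full_extending_datum ::
  "('k::field \<Rightarrow> 'a \<Rightarrow> 'a) \<Rightarrow> ('k \<Rightarrow> 'v \<Rightarrow> 'v) \<Rightarrow> nat \<Rightarrow> 'a::ab_group_add set \<Rightarrow> 'v::ab_group_add set \<Rightarrow>
    (nat \<Rightarrow> 'v list \<Rightarrow> 'a list \<Rightarrow> 'a) \<Rightarrow> (nat \<Rightarrow> 'v list \<Rightarrow> 'a list \<Rightarrow> 'v) \<Rightarrow> bool"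
  where "full_extending_datum s t n g V \<Gamma>g \<Gamma>V \<longleftrightarrow>
    module.subspace s g \<and> module.subspace t V \<and>
    (\<forall>k\<in>{1..n}. bi_alternating_map t V k s g (n - k) s g (\<Gamma>g k) \<and>
                bi_alternating_map t V k s g (n - k) t V (\<Gamma>V k))"

text \<open>The element of \<open>g \<oplus> V = g \<times> V\<close> obtained from the \<open>k\<close>-th pair of maps, with the convention
  for \<open>k = 0\<close>.\<close>

definition datum_value ::
  "('a list \<Rightarrow> 'a) \<Rightarrow> (nat \<Rightarrow> 'v list \<Rightarrow> 'a list \<Rightarrow> 'a) \<Rightarrow> (nat \<Rightarrow> 'v list \<Rightarrow> 'a list \<Rightarrow> 'v::zero) \<Rightarrow>
    nat \<Rightarrow> 'v list \<Rightarrow> 'a list \<Rightarrow> 'a \<times> 'v"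
  where "datum_value br \<Gamma>g \<Gamma>V k us xs = (if k = 0 then (br xs, 0) else (\<Gamma>g k us xs, \<Gamma>V k us xs))"

text \<open>The operation on \<open>g \<times> V\<close>: \<open>I\<close> is the set of positions \<open>i\<^sub>1 < \<dots> < i\<^sub>k\<close>, counted from \<open>1\<close>,
  whereas list positions count from \<open>0\<close>. The exponent of the sign is never negative, so the
  truncated subtraction is harmless.\<close>

definition full_bracket ::
  "('k::field \<Rightarrow> 'a \<Rightarrow> 'a) \<Rightarrow> ('k \<Rightarrow> 'v \<Rightarrow> 'v) \<Rightarrow> nat \<Rightarrow> ('a list \<Rightarrow> 'a) \<Rightarrow>
    (nat \<Rightarrow> 'v list \<Rightarrow> 'a list \<Rightarrow> 'a) \<Rightarrow> (nat \<Rightarrow> 'v list \<Rightarrow> 'a list \<Rightarrow> 'v) \<Rightarrow>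
    ('a::ab_group_add \<times> 'v::ab_group_add) list \<Rightarrow> 'a \<times> 'v"
  where "full_bracket s t n br \<Gamma>g \<Gamma>V ws =
    (\<Sum>k\<le>n. \<Sum>I\<in>{I. I \<subseteq> {1..n} \<and> card I = k}.
      module_prod.scale s t ((- 1) ^ (\<Sum>I - k * (k + 1) div 2))
        (datum_value br \<Gamma>g \<Gamma>V k
          (map (\<lambda>i. snd (ws ! (i - 1))) (sorted_list_of_set I))
          (map (\<lambda>j. fst (ws ! (j - 1))) (sorted_list_of_set ({1..n} - I)))))"

definition full_extending_structure ::
  "('k::field \<Rightarrow> 'a \<Rightarrow> 'a) \<Rightarrow> ('k \<Rightarrow> 'v \<Rightarrow> 'v) \<Rightarrow> nat \<Rightarrow> 'a::ab_group_add set \<Rightarrow> ('a list \<Rightarrow> 'a) \<Rightarrow>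
    'v::ab_group_add set \<Rightarrow> (nat \<Rightarrow> 'v list \<Rightarrow> 'a list \<Rightarrow> 'a) \<Rightarrow> (nat \<Rightarrow> 'v list \<Rightarrow> 'a list \<Rightarrow> 'v) \<Rightarrow> bool"
  where "full_extending_structure s t n g br V \<Gamma>g \<Gamma>V \<longleftrightarrow>
    full_extending_datum s t n g V \<Gamma>g \<Gamma>V \<and>
    filippov_identity (g \<times> V) n (full_bracket s t n br \<Gamma>g \<Gamma>V)"

definition coset_space :: "'a::ab_group_add set \<Rightarrow> 'a set \<Rightarrow> 'a set set"
  where "coset_space E S = (\<lambda>e. e +o S) ` E"

end

theory Submission
  imports Defs
begin

text \<open>Both directions rest on one formula. Write the bracket on \<open>g \<oplus> V\<close> as the signed sum, over all
  ways to choose from each argument \<open>x\<^sub>i + u\<^sub>i\<close> one of its two components, of the datum evaluated at the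
  chosen \<open>u\<close>'s followed by the chosen \<open>x\<close>'s. The sign in the definition is the sign of the shuffle that
  sorts the arguments in this way, so it counts the inversions, the pairs with an \<open>x\<close> standing before
  a \<open>u\<close>. Choosing the components one argument at a time, from the last one to the first, turns the sum
  over subsets into a recursion (\<open>shuffle_sum\<close>, \<open>full_bracket_eq_shuffle_sum\<close>), and every property
  below is an induction along it.

  For the converse, the Filippov identity is a hypothesis and what must be shown is that the operation
  is multilinear and alternating (\<open>shuffle_sum_alternating_map\<close>). By polarisation it is enough that it
  vanishes at two equal neighbours \<open>x + u, x + u\<close> (\<open>alternating_on_adjacentI\<close>): the choices \<open>u, u\<close> and
  \<open>x, x\<close> contribute zero, and the choices \<open>u, x\<close> and \<open>x, u\<close> give the same value with opposite signs
  (\<open>shuffle_sum_adjacent_eq\<close>).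

  For an extension \<open>E\<close>, let \<open>\<Psi> e = (p e, q e)\<close>, the inverse of \<open>\<Phi>\<close>. Expanding an alternating map along
  the decomposition of its arguments and sorting each term gives the same shuffle sum
  (\<open>alternating_map_expand\<close>). Applied to \<open>\<Psi>\<close> after the bracket of \<open>E\<close>, this says that the bracket of the
  datum is the bracket of \<open>E\<close> transported along \<open>\<Phi>\<close> (\<open>full_bracket_eq\<close>); the Filippov identity, and
  with it the isomorphism, is transported too.\<close>


section \<open>Linear, multilinear and alternating maps on subspaces\<close>

lemma linear_onD:
  assumes "linear_on s t S f" "x \<in> S"
  shows "y \<in> S \<Longrightarrow> f (x + y) = f x + f y" and "f (s c x) = t c (f x)"
  using assms by (auto simp: linear_on_def)

lemma linear_on_plus:
  assumes "module t" "linear_on s t S f" "linear_on s t S h"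
  shows "linear_on s t S (\<lambda>x. f x + h x)"
proof -
  interpret module t by fact
  show ?thesis using assms(2,3) by (auto simp: linear_on_def scale_right_distrib)
qed

lemma linear_on_compose:
  assumes "linear_on s t S f" "linear_on t r T h" "f ` S \<subseteq> T"
  shows "linear_on s r S (\<lambda>x. h (f x))"
  using assms by (auto simp: linear_on_def image_subset_iff)

lemma linear_on_sum:
  assumes "module s" "module t" "module.subspace s S" "linear_on s t S f"
    and "\<And>i. i \<in> I \<Longrightarrow> h i \<in> S"
  shows "f (\<Sum>i\<in>I. h i) = (\<Sum>i\<in>I. f (h i))"
proof -
  interpret s: module s by fact
  interpret t: module t by fact
  have f0: "f 0 = 0"
    using linear_onD(2)[OF assms(4) s.subspace_0[OF assms(3)], of 0] by simp
  show ?thesis using assms(5)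
  proof (induction I rule: infinite_finite_induct)
    case (insert i I)
    then show ?case
      using linear_onD(1)[OF assms(4), of "h i" "sum h I"] s.subspace_sum[OF assms(3), of I h]
      by simp
  qed (simp_all add: f0)
qed

text \<open>Splitting the argument list at the varying position, instead of updating it there, lets
  inductions on lists apply.\<close>

lemma multilinear_on_iff:
  "multilinear_on s t S m f \<longleftrightarrow>
    (\<forall>as bs. set as \<subseteq> S \<longrightarrow> set bs \<subseteq> S \<longrightarrow> Suc (length as + length bs) = m \<longrightarrow>
      linear_on s t S (\<lambda>y. f (as @ y # bs)))" (is "?L = ?R")
proof
  assume f: ?L
  show ?R
  proof (intro allI impI)
    fix as bs assume S: "set as \<subseteq> S" "set bs \<subseteq> S" and m: "Suc (length as + length bs) = m"
    have by_elem: "linear_on s t S (\<lambda>y. f (as @ y # bs))" if "z \<in> S" for z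
    proof -
      have 1: "as @ z # bs \<in> nlists m S" using S m that unfolding nlists_def by simp
      have 2: "length as < m" using m by simp
      have "linear_on s t S (\<lambda>y. f ((as @ z # bs)[length as := y]))"
        using f[unfolded multilinear_on_def, THEN bspec, OF 1] 2 by blast
      then show ?thesis by simp
    qed
    show "linear_on s t S (\<lambda>y. f (as @ y # bs))"
    proof (cases "S = {}")
      case True
      then show ?thesis by (simp add: linear_on_def)
    next
      case False
      then show ?thesis using by_elem by blast
    qed
  qed
next
  assume f: ?R
  show ?L
    unfolding multilinear_on_def
  proof (intro ballI allI impI)
    fix xs i assume xs: "xs \<in> nlists m S" and i: "i < m"
    have xs': "set xs \<subseteq> S" "length xs = m" using xs by auto
    have 1: "set (take i xs) \<subseteq> S" using set_take_subset[of i xs] xs' by blast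
    have 2: "set (drop (Suc i) xs) \<subseteq> S" using set_drop_subset[of "Suc i" xs] xs' by blast
    have 3: "Suc (length (take i xs) + length (drop (Suc i) xs)) = m"
      using xs' i by simp
    have "linear_on s t S (\<lambda>y. f (take i xs @ y # drop (Suc i) xs))"
      using f 1 2 3 by simp
    then show "linear_on s t S (\<lambda>y. f (xs[i := y]))"
      using xs' i by (simp only: upd_conv_take_nth_drop)
  qed
qed

text \<open>Polarisation: expand the value at two equal neighbours \<open>x + y, x + y\<close>.\<close>

lemma adjacent_swap:
  assumes f: "multilinear_on s t S m f"
    and sub: "module s" "module.subspace s S"
    and eq0: "\<And>as y bs. set as \<subseteq> S \<Longrightarrow> y \<in> S \<Longrightarrow> set bs \<subseteq> S \<Longrightarrow>
      Suc (Suc (length as + length bs)) = m \<Longrightarrow> f (as @ y # y # bs) = 0"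
    and S: "set as \<subseteq> S" "x \<in> S" "y \<in> S" "set bs \<subseteq> S"
    and m: "Suc (Suc (length as + length bs)) = m"
  shows "f (as @ x # y # bs) = - f (as @ y # x # bs)"
proof -
  interpret module s by fact
  have xy: "x + y \<in> S" using S sub(2) by (simp add: subspace_add)
  have l1: "linear_on s t S (\<lambda>z. f (as @ z # (x + y) # bs))"
    by (rule f[unfolded multilinear_on_iff, rule_format]) (use S m xy in auto)
  have l2: "linear_on s t S (\<lambda>w. f (as @ z # w # bs))" if "z \<in> S" for z
  proof -
    have "linear_on s t S (\<lambda>w. f ((as @ [z]) @ w # bs))"
      by (rule f[unfolded multilinear_on_iff, rule_format]) (use S m that in auto)
    then show ?thesis by simp
  qed
  have "0 = f (as @ (x + y) # (x + y) # bs)"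
    using eq0 S m xy by simp
  also have "\<dots> = f (as @ x # (x + y) # bs) + f (as @ y # (x + y) # bs)"
    by (rule linear_onD(1)[OF l1 S(2,3)])
  also have "\<dots> = (f (as @ x # x # bs) + f (as @ x # y # bs))
      + (f (as @ y # x # bs) + f (as @ y # y # bs))"
    using linear_onD(1)[OF l2[OF S(2)] S(2,3)] linear_onD(1)[OF l2[OF S(3)] S(2,3)] by simp
  also have "\<dots> = f (as @ x # y # bs) + f (as @ y # x # bs)"
    using eq0 S m by simp
  finally show ?thesis by (simp add: eq_neg_iff_add_eq_0)
qed

text \<open>Two equal arguments are brought next to each other by adjacent swaps, each of which only
  changes the sign.\<close>

lemma alternating_on_adjacentI:
  assumes f: "multilinear_on s t S m f"
    and sub: "module s" "module.subspace s S"
    and eq0: "\<And>as y bs. set as \<subseteq> S \<Longrightarrow> y \<in> S \<Longrightarrow> set bs \<subseteq> S \<Longrightarrow>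
      Suc (Suc (length as + length bs)) = m \<Longrightarrow> f (as @ y # y # bs) = 0"
  shows "alternating_on S m f"
  unfolding alternating_on_def
proof (intro ballI impI)
  have gen: "f (as @ y # bs @ y # cs) = 0"
    if "set as \<subseteq> S" "y \<in> S" "set bs \<subseteq> S" "set cs \<subseteq> S"
      "Suc (Suc (length as + length bs + length cs)) = m" for as y bs cs
    using that
  proof (induction bs arbitrary: as)
    case Nil
    then show ?case using eq0 by simp
  next
    case (Cons b bs)
    have "f (as @ y # b # (bs @ y # cs)) = - f (as @ b # y # (bs @ y # cs))"
      using Cons.prems by (intro adjacent_swap[OF f sub eq0]) auto
    also have "f (as @ b # y # (bs @ y # cs)) = 0"
      using Cons.IH[of "as @ [b]"] Cons.prems by auto
    finally show ?case by simp
  qed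
  fix xs assume xs: "xs \<in> nlists m S" "\<not> distinct xs"
  then obtain as y bs cs where "xs = as @ [y] @ bs @ [y] @ cs"
    using not_distinct_decomp by blast
  then show "f xs = 0" using gen[of as y bs cs] xs(1) unfolding nlists_def by simp
qed


section \<open>The sum over shuffles\<close>

text \<open>The sign \<open>(- 1) ^ e\<close>, written so that no scalars are involved.\<close>

definition signed :: "nat \<Rightarrow> 'a::ab_group_add \<Rightarrow> 'a"
  where "signed e v = (if even e then v else - v)"

lemma signed_0 [simp]: "signed 0 v = v" "signed e 0 = 0"
  by (simp_all add: signed_def)

lemma signed_Suc: "signed (Suc e) v = - signed e v"
  by (simp add: signed_def)

lemma signed_signed: "signed a (signed b v) = signed (a + b) v"
  by (simp add: signed_def)

lemma signed_cong_parity: "even a = even b \<Longrightarrow> signed a v = signed b v"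
  by (simp add: signed_def)

lemma signed_sum: "signed e (sum f A) = (\<Sum>x\<in>A. signed e (f x))"
  by (simp add: signed_def sum_negf)

lemma scale_minus_one_power:
  assumes "module r" shows "r ((- 1) ^ e) v = signed e v"
proof -
  interpret module r by fact
  show ?thesis by (simp add: signed_def)
qed

lemma signed_in_subspace:
  assumes "module r" "module.subspace r T" "v \<in> T" shows "signed e v \<in> T"
  using assms by (simp add: signed_def module.subspace_neg)

lemma linear_on_signed:
  assumes "module t" "linear_on s t S f" shows "linear_on s t S (\<lambda>x. signed e (f x))"
proof -
  interpret module t by fact
  show ?thesis using assms(2) by (auto simp: linear_on_def signed_def)
qed

text \<open>The last of the \<open>n\<close> remaining arguments is put in front of the \<open>u\<close>'s or of the \<open>x\<close>'s already chosen
  from the arguments behind it. In the second case the new \<open>x\<close> precedes all \<open>length us\<close> of those \<open>u\<close>'s in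
  the original order, hence the sign.\<close>

fun shuffle_sum ::
  "('v list \<Rightarrow> 'a list \<Rightarrow> 'w::ab_group_add) \<Rightarrow> (nat \<Rightarrow> 'a \<times> 'v) \<Rightarrow> nat \<Rightarrow> 'v list \<Rightarrow> 'a list \<Rightarrow> 'w"
  where
    "shuffle_sum F w 0 us xs = F us xs"
  | "shuffle_sum F w (Suc n) us xs =
      shuffle_sum F w n (snd (w n) # us) xs
      + signed (length us) (shuffle_sum F w n us (fst (w n) # xs))"

lemma shuffle_sum_cong:
  assumes "\<And>i. i < n \<Longrightarrow> w i = w' i"
  shows "shuffle_sum F w n us xs = shuffle_sum F w' n us xs"
  using assms by (induction n arbitrary: us xs) simp_all

lemma shuffle_sum_cong_value:
  assumes "\<And>us xs. set us \<subseteq> V \<Longrightarrow> set xs \<subseteq> g \<Longrightarrow> length us + length xs = N \<Longrightarrow> F us xs = F' us xs"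
    and "\<And>i. i < n \<Longrightarrow> w i \<in> g \<times> V" "set us \<subseteq> V" "set xs \<subseteq> g" "n + length us + length xs = N"
  shows "shuffle_sum F w n us xs = shuffle_sum F' w n us xs"
  using assms(2-)
proof (induction n arbitrary: us xs)
  case 0
  then show ?case using assms(1) by simp
next
  case (Suc n)
  have wn: "fst (w n) \<in> g" "snd (w n) \<in> V"
    using Suc.prems(1)[of n] by (auto simp: mem_Times_iff)
  have "shuffle_sum F w n (snd (w n) # us) xs = shuffle_sum F' w n (snd (w n) # us) xs"
    by (rule Suc.IH) (use Suc.prems wn in auto)
  moreover have "shuffle_sum F w n us (fst (w n) # xs) = shuffle_sum F' w n us (fst (w n) # xs)"
    by (rule Suc.IH) (use Suc.prems wn in auto)
  ultimately show ?case by simp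
qed

text \<open>The elements of \<open>I\<close>, in increasing order, are at least \<open>1, 2, 3, \<dots>\<close>. Hence the exponent
  \<open>\<Sum>I - k * (k + 1) div 2\<close> is a true difference and has the parity of the corresponding sum.\<close>

lemma triangle_le_sum:
  assumes "finite I" "0 \<notin> I"
  shows "card I * (card I + 1) div 2 \<le> \<Sum>(I :: nat set)"
  using assms
proof (induction I rule: finite_linorder_max_induct)
  case empty
  then show ?case by simp
next
  case (insert b I)
  have "I \<subseteq> {1..<b}"
    using insert by (auto simp: Suc_le_eq intro: gr0I)
  then have "card I \<le> b - 1" by (metis card_atLeastLessThan card_mono finite_atLeastLessThan)
  moreover have "b \<noteq> 0" using insert by auto
  moreover have "Suc (card I) * (Suc (card I) + 1) div 2 = card I * (card I + 1) div 2 + Suc (card I)"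
    by simp
  moreover have "b \<notin> I" using insert by auto
  ultimately show ?case using insert by (simp del: mult_Suc)
qed

lemma sorted_list_of_set_insert_Suc:
  assumes "I \<subseteq> {1..n}"
  shows "sorted_list_of_set (insert (Suc n) I) = sorted_list_of_set I @ [Suc n]"
proof -
  have fin: "finite I" using assms finite_subset by blast
  have "sorted_wrt (<) (sorted_list_of_set I @ [Suc n])"
    using assms fin by (auto simp: sorted_wrt_append)
  moreover have "set (sorted_list_of_set I @ [Suc n]) = insert (Suc n) I"
    using fin by auto
  ultimately show ?thesis
    by (metis sorted_list_of_set.idem_if_sorted_distinct strict_sorted_iff)
qed

text \<open>The sum is split according to whether \<open>n + 1\<close> lies in \<open>I\<close>. If it does, it forms an inversion with
  each of the \<open>n - card I\<close> complementary indices, and becomes one more entry of \<open>us\<close>. The summand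
  \<open>length us * (n - card I)\<close> of the exponent accounts for the inversions between the entries of \<open>us\<close>,
  which stand behind all indices, and the complementary indices; without it the induction does not
  go through.\<close>

lemma sum_subsets_eq_shuffle_sum:
  "(\<Sum>I\<in>Pow {1..n}. signed (\<Sum>I + card I * (card I + 1) div 2 + length us * (n - card I))
      (F (map (\<lambda>i. snd (w (i - 1))) (sorted_list_of_set I) @ us)
         (map (\<lambda>j. fst (w (j - 1))) (sorted_list_of_set ({1..n} - I)) @ xs)))
    = shuffle_sum F w n us xs"
proof (induction n arbitrary: us xs)
  case 0
  then show ?case by simp
next
  case (Suc n)
  define G where "G = (\<lambda>n us xs I.
     signed (\<Sum>I + card I * (card I + 1) div 2 + length us * (n - card I))
      (F (map (\<lambda>i. snd (w (i - 1))) (sorted_list_of_set I) @ us)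
         (map (\<lambda>j. fst (w (j - 1))) (sorted_list_of_set ({1..n} - I)) @ xs)))"
  have IH: "sum (G n us xs) (Pow {1..n}) = shuffle_sum F w n us xs" for us xs
    using Suc.IH unfolding G_def .
  have Pow: "Pow {1..Suc n} = insert (Suc n) ` Pow {1..n} \<union> Pow {1..n}"
    by (simp add: atLeastAtMostSuc_conv Pow_insert Un_commute)
  have inj: "inj_on (insert (Suc n)) (Pow {1..n})"
    by (auto simp: inj_on_def set_eq_iff) (metis Suc_n_not_le_n atLeastAtMost_iff subsetD)+
  have "sum (G (Suc n) us xs) (Pow {1..Suc n})
      = (\<Sum>I\<in>Pow {1..n}. G (Suc n) us xs (insert (Suc n) I)) + (\<Sum>I\<in>Pow {1..n}. G (Suc n) us xs I)"
    unfolding Pow by (subst sum.union_disjoint) (auto simp: sum.reindex[OF inj, simplified])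
  also have "(\<Sum>I\<in>Pow {1..n}. G (Suc n) us xs (insert (Suc n) I))
      = (\<Sum>I\<in>Pow {1..n}. G n (snd (w n) # us) xs I)"
  proof (rule sum.cong)
    fix I assume "I \<in> Pow {1..n}"
    then have I: "I \<subseteq> {1..n}" by simp
    have fin: "finite I" and notin: "Suc n \<notin> I" using I finite_subset by auto
    have le: "card I \<le> n" using card_mono[OF _ I] by simp
    have diff: "{1..Suc n} - insert (Suc n) I = {1..n} - I" by auto
    have tri: "Suc (card I) * (Suc (card I) + 1) div 2 = card I * (card I + 1) div 2 + Suc (card I)"
      by simp
    have card: "card (insert (Suc n) I) = Suc (card I)" and sum: "\<Sum>(insert (Suc n) I) = Suc n + \<Sum>I"
      using fin notin by simp_all
    obtain d where d: "n = card I + d" using le le_Suc_ex by blast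
    have parity: "even (Suc n + \<Sum>I + (card I * (card I + 1) div 2 + Suc (card I)) + length us * (Suc n - Suc (card I)))
      = even (\<Sum>I + card I * (card I + 1) div 2 + length (snd (w n) # us) * (n - card I))"
      unfolding d by (simp only: diff_Suc_Suc diff_add_inverse) (simp only: even_add even_Suc even_mult_iff length_Cons, blast)
    show "G (Suc n) us xs (insert (Suc n) I) = G n (snd (w n) # us) xs I"
      unfolding G_def card sum tri diff sorted_list_of_set_insert_Suc[OF I]
      by (simp only: signed_cong_parity[OF parity] map_append append_assoc append_Cons append_Nil list.map diff_Suc_1)
  qed simp
  also have "(\<Sum>I\<in>Pow {1..n}. G (Suc n) us xs I)
      = (\<Sum>I\<in>Pow {1..n}. signed (length us) (G n us (fst (w n) # xs) I))"
  proof (rule sum.cong)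
    fix I assume "I \<in> Pow {1..n}"
    then have I: "I \<subseteq> {1..n}" by simp
    have le: "card I \<le> n" using card_mono[OF _ I] by simp
    have diff: "{1..Suc n} - I = insert (Suc n) ({1..n} - I)" using I by auto
    have "sorted_list_of_set ({1..Suc n} - I) = sorted_list_of_set ({1..n} - I) @ [Suc n]"
      unfolding diff by (rule sorted_list_of_set_insert_Suc) auto
    then show "G (Suc n) us xs I = signed (length us) (G n us (fst (w n) # xs) I)"
      unfolding G_def using le
      by (simp add: signed_signed Suc_diff_le add_ac)
  qed simp
  finally have "sum (G (Suc n) us xs) (Pow {1..Suc n}) = shuffle_sum F w (Suc n) us xs"
    by (simp only: IH signed_sum[symmetric] shuffle_sum.simps)
  then show ?case unfolding G_def .
qed

lemma full_bracket_eq_shuffle_sum: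
  assumes "vector_space s" "vector_space t"
  shows "full_bracket s t n br \<Gamma>g \<Gamma>V ws =
    shuffle_sum (\<lambda>us. datum_value br \<Gamma>g \<Gamma>V (length us) us) ((!) ws) n [] []"
proof -
  interpret s: vector_space s by fact
  interpret t: vector_space t by fact
  interpret vector_space_prod s t ..
  define F where "F = (\<lambda>us. datum_value br \<Gamma>g \<Gamma>V (length us) us)"
  define h where "h = (\<lambda>I. signed (\<Sum>I + card I * (card I + 1) div 2)
        (F (map (\<lambda>i. snd (ws ! (i - 1))) (sorted_list_of_set I))
           (map (\<lambda>j. fst (ws ! (j - 1))) (sorted_list_of_set ({1..n} - I)))))"
  have "scale ((- 1) ^ (\<Sum>I - k * (k + 1) div 2))
        (datum_value br \<Gamma>g \<Gamma>V k
          (map (\<lambda>i. snd (ws ! (i - 1))) (sorted_list_of_set I))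
          (map (\<lambda>j. fst (ws ! (j - 1))) (sorted_list_of_set ({1..n} - I)))) = h I"
    if "I \<subseteq> {1..n}" "card I = k" for I k
  proof -
    have "finite I" "0 \<notin> I" using that finite_subset by auto
    then have "k * (k + 1) div 2 \<le> \<Sum>I" using triangle_le_sum[of I] that by simp
    then have "even (\<Sum>I - k * (k + 1) div 2) = even (\<Sum>I + k * (k + 1) div 2)" by simp
    then show ?thesis
      unfolding h_def F_def scale_minus_one_power[OF p.module_axioms]
      using that \<open>finite I\<close> by (auto intro: signed_cong_parity)
  qed
  then have "full_bracket s t n br \<Gamma>g \<Gamma>V ws = (\<Sum>k\<le>n. \<Sum>I\<in>{I. I \<subseteq> {1..n} \<and> card I = k}. h I)"
    unfolding full_bracket_def by (intro sum.cong refl) simp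
  also have "\<dots> = (\<Sum>k\<le>n. \<Sum>I\<in>{I \<in> Pow {1..n}. card I = k}. h I)"
    by simp
  also have "\<dots> = (\<Sum>I\<in>Pow {1..n}. h I)"
    by (rule sum.group) (auto dest: card_mono[rotated])
  also have "\<dots> = shuffle_sum F ((!) ws) n [] []"
    using sum_subsets_eq_shuffle_sum[of "[]" n F "(!) ws" "[]"] by (simp add: h_def)
  finally show ?thesis unfolding F_def .
qed


section \<open>The shuffle sum is alternating\<close>

text \<open>The shuffle sum evaluates \<open>F\<close> at all pairs of lists of total length \<open>N\<close>, so that the maps with
  \<open>0 \<le> k \<le> N\<close> arguments from \<open>V\<close> are combined in one function.\<close>

definition bi_alternating_family ::
  "('k \<Rightarrow> 'v \<Rightarrow> 'v) \<Rightarrow> 'v::ab_group_add set \<Rightarrow> ('k \<Rightarrow> 'a \<Rightarrow> 'a) \<Rightarrow> 'a::ab_group_add set \<Rightarrow>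
    ('k \<Rightarrow> 'w \<Rightarrow> 'w) \<Rightarrow> 'w::ab_group_add set \<Rightarrow> nat \<Rightarrow> ('v list \<Rightarrow> 'a list \<Rightarrow> 'w) \<Rightarrow> bool"
  where "bi_alternating_family t V s g r W N F \<longleftrightarrow>
    (\<forall>k m. k + m = N \<longrightarrow> bi_alternating_map t V k s g m r W F)"

lemma bi_alternating_familyD:
  assumes F: "bi_alternating_family t V s g r W N F"
    and us: "set us \<subseteq> V" and xs: "set xs \<subseteq> g"
  shows "length us + length xs = N \<Longrightarrow> F us xs \<in> W"
    and "length us + length xs = N \<Longrightarrow> \<not> distinct us \<or> \<not> distinct xs \<Longrightarrow> F us xs = 0"
    and "Suc (length us + length us' + length xs) = N \<Longrightarrow> set us' \<subseteq> V \<Longrightarrow>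
      linear_on t r V (\<lambda>y. F (us @ y # us') xs)"
    and "Suc (length us + length xs + length xs') = N \<Longrightarrow> set xs' \<subseteq> g \<Longrightarrow>
      linear_on s r g (\<lambda>y. F us (xs @ y # xs'))"
proof -
  have left: "alternating_map t V r W k (\<lambda>us. F us xs)" if "k + length xs = N" for k
    using F that xs unfolding bi_alternating_family_def bi_alternating_map_def nlists_def by blast
  have right: "alternating_map s g r W m (F us)" if "length us + m = N" for m
    using F that us unfolding bi_alternating_family_def bi_alternating_map_def nlists_def by blast
  show "F us xs \<in> W" if N: "length us + length xs = N"
    using right[OF N] xs unfolding alternating_map_def nlists_def by blast
  show "F us xs = 0" if N: "length us + length xs = N" and "\<not> distinct us \<or> \<not> distinct xs"
    using right[OF N] left[OF N] us xs that
    unfolding alternating_map_def alternating_on_def nlists_def by blast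
  show "linear_on t r V (\<lambda>y. F (us @ y # us') xs)"
    if N: "Suc (length us + length us' + length xs) = N" and us': "set us' \<subseteq> V"
  proof -
    have "multilinear_on t r V (Suc (length us + length us')) (\<lambda>us. F us xs)"
      using left[of "Suc (length us + length us')"] N unfolding alternating_map_def by simp
    from this[unfolded multilinear_on_iff, rule_format, OF us us' refl] show ?thesis .
  qed
  show "linear_on s r g (\<lambda>y. F us (xs @ y # xs'))"
    if N: "Suc (length us + length xs + length xs') = N" and xs': "set xs' \<subseteq> g"
  proof -
    have "multilinear_on s r g (Suc (length xs + length xs')) (F us)"
      using right[of "Suc (length xs + length xs')"] N unfolding alternating_map_def by simp
    from this[unfolded multilinear_on_iff, rule_format, OF xs xs' refl] show ?thesis .
  qed
qed

lemma shuffle_sum_closed: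
  assumes "module r" "module.subspace r W"
    and F: "bi_alternating_family t V s g r W N F"
    and "\<And>i. i < n \<Longrightarrow> w i \<in> g \<times> V" "set us \<subseteq> V" "set xs \<subseteq> g" "n + length us + length xs = N"
  shows "shuffle_sum F w n us xs \<in> W"
  using assms(4-)
proof (induction n arbitrary: us xs)
  case 0
  then show ?case using bi_alternating_familyD(1)[OF F] by simp
next
  case (Suc n)
  have wn: "fst (w n) \<in> g" "snd (w n) \<in> V"
    using Suc.prems(1)[of n] by (auto simp: mem_Times_iff)
  have "shuffle_sum F w n (snd (w n) # us) xs \<in> W"
    by (rule Suc.IH) (use Suc.prems wn in auto)
  moreover have "shuffle_sum F w n us (fst (w n) # xs) \<in> W"
    by (rule Suc.IH) (use Suc.prems wn in auto)
  ultimately show ?case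
    using assms(1,2) by (simp add: module.subspace_add signed_in_subspace)
qed

text \<open>The recursion only adds entries in front of \<open>us\<close> and \<open>xs\<close>, so a repetition persists in every term.\<close>

lemma shuffle_sum_not_distinct:
  assumes F: "bi_alternating_family t V s g r W N F"
    and "\<And>i. i < n \<Longrightarrow> w i \<in> g \<times> V" "set us \<subseteq> V" "set xs \<subseteq> g" "n + length us + length xs = N"
    and "\<not> distinct us \<or> \<not> distinct xs"
  shows "shuffle_sum F w n us xs = 0"
  using assms(2-)
proof (induction n arbitrary: us xs)
  case 0
  then show ?case using bi_alternating_familyD(2)[OF F] by simp
next
  case (Suc n)
  have wn: "fst (w n) \<in> g" "snd (w n) \<in> V"
    using Suc.prems(1)[of n] by (auto simp: mem_Times_iff)
  have "shuffle_sum F w n (snd (w n) # us) xs = 0"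
    by (rule Suc.IH) (use Suc.prems wn in auto)
  moreover have "shuffle_sum F w n us (fst (w n) # xs) = 0"
    by (rule Suc.IH) (use Suc.prems wn in auto)
  ultimately show ?case by simp
qed

lemma shuffle_sum_linear_left:
  assumes "module r" and F: "bi_alternating_family t V s g r W N F"
    and "\<And>i. i < n \<Longrightarrow> w i \<in> g \<times> V" "set us \<subseteq> V" "set us' \<subseteq> V" "set xs \<subseteq> g"
    and "Suc (n + length us + length us' + length xs) = N"
  shows "linear_on t r V (\<lambda>y. shuffle_sum F w n (us @ y # us') xs)"
  using assms(3-)
proof (induction n arbitrary: us xs)
  case 0
  then show ?case using bi_alternating_familyD(3)[OF F, of us xs us'] by simp
next
  case (Suc n)
  have wn: "fst (w n) \<in> g" "snd (w n) \<in> V"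
    using Suc.prems(1)[of n] by (auto simp: mem_Times_iff)
  have "linear_on t r V (\<lambda>y. shuffle_sum F w n ((snd (w n) # us) @ y # us') xs)"
    by (rule Suc.IH) (use Suc.prems wn in auto)
  moreover have "linear_on t r V (\<lambda>y. shuffle_sum F w n (us @ y # us') (fst (w n) # xs))"
    by (rule Suc.IH) (use Suc.prems wn in auto)
  ultimately show ?case
    using assms(1) by (simp add: linear_on_plus linear_on_signed)
qed

lemma shuffle_sum_linear_right:
  assumes "module r" and F: "bi_alternating_family t V s g r W N F"
    and "\<And>i. i < n \<Longrightarrow> w i \<in> g \<times> V" "set us \<subseteq> V" "set xs \<subseteq> g" "set xs' \<subseteq> g"
    and "Suc (n + length us + length xs + length xs') = N"
  shows "linear_on s r g (\<lambda>y. shuffle_sum F w n us (xs @ y # xs'))"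
  using assms(3-)
proof (induction n arbitrary: us xs)
  case 0
  then show ?case using bi_alternating_familyD(4)[OF F, of us xs xs'] by simp
next
  case (Suc n)
  have wn: "fst (w n) \<in> g" "snd (w n) \<in> V"
    using Suc.prems(1)[of n] by (auto simp: mem_Times_iff)
  have "linear_on s r g (\<lambda>y. shuffle_sum F w n (snd (w n) # us) (xs @ y # xs'))"
    by (rule Suc.IH) (use Suc.prems wn in auto)
  moreover have "linear_on s r g (\<lambda>y. shuffle_sum F w n us ((fst (w n) # xs) @ y # xs'))"
    by (rule Suc.IH) (use Suc.prems wn in auto)
  ultimately show ?case
    using assms(1) by (simp add: linear_on_plus linear_on_signed)
qed

lemma linear_on_fst: "module_prod s t \<Longrightarrow> linear_on (module_prod.scale s t) s (g \<times> V) fst"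
  and linear_on_snd: "module_prod s t \<Longrightarrow> linear_on (module_prod.scale s t) t (g \<times> V) snd"
  by (auto simp: linear_on_def module_prod.scale_def)

text \<open>When the recursion reaches position \<open>i\<close>, the argument there splits into its two components, and
  linearity in an entry of \<open>us\<close> or of \<open>xs\<close> takes over.\<close>

lemma shuffle_sum_linear:
  assumes "module r" and st: "module_prod s t" and F: "bi_alternating_family t V s g r W N F"
    and "i < n" "\<And>i. i < n \<Longrightarrow> w i \<in> g \<times> V" "set us \<subseteq> V" "set xs \<subseteq> g" "n + length us + length xs = N"
  shows "linear_on (module_prod.scale s t) r (g \<times> V) (\<lambda>y. shuffle_sum F (w(i := y)) n us xs)"
  using assms(4-)
proof (induction n arbitrary: us xs)
  case 0
  then show ?case by simp
next
  case (Suc n)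
  have wn: "fst (w n) \<in> g" "snd (w n) \<in> V"
    using Suc.prems(2)[of n] by (auto simp: mem_Times_iff)
  have "linear_on (module_prod.scale s t) r (g \<times> V)
      (\<lambda>y. shuffle_sum F (w(i := y)) n (snd ((w(i := y)) n) # us) xs) \<and>
    linear_on (module_prod.scale s t) r (g \<times> V)
      (\<lambda>y. shuffle_sum F (w(i := y)) n us (fst ((w(i := y)) n) # xs))"
  proof (cases "i = n")
    case True
    have cong: "shuffle_sum F (w(n := y)) n us xs = shuffle_sum F w n us xs" for y us xs
      by (rule shuffle_sum_cong) simp
    have "linear_on t r V (\<lambda>y. shuffle_sum F w n ([] @ y # us) xs)"
      by (rule shuffle_sum_linear_left[OF assms(1) F]) (use Suc.prems in auto)
    from linear_on_compose[OF linear_on_snd[OF st, of g V] this]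
    have 1: "linear_on (module_prod.scale s t) r (g \<times> V) (\<lambda>y. shuffle_sum F w n (snd y # us) xs)"
      by auto
    have "linear_on s r g (\<lambda>y. shuffle_sum F w n us ([] @ y # xs))"
      by (rule shuffle_sum_linear_right[OF assms(1) F]) (use Suc.prems in auto)
    from linear_on_compose[OF linear_on_fst[OF st, of g V] this]
    have 2: "linear_on (module_prod.scale s t) r (g \<times> V) (\<lambda>y. shuffle_sum F w n us (fst y # xs))"
      by auto
    show ?thesis using 1 2 True by (simp add: cong)
  next
    case False
    have "linear_on (module_prod.scale s t) r (g \<times> V)
        (\<lambda>y. shuffle_sum F (w(i := y)) n (snd (w n) # us) xs)"
      by (rule Suc.IH) (use Suc.prems wn False in auto)
    moreover have "linear_on (module_prod.scale s t) r (g \<times> V)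
        (\<lambda>y. shuffle_sum F (w(i := y)) n us (fst (w n) # xs))"
      by (rule Suc.IH) (use Suc.prems wn False in auto)
    ultimately show ?thesis using False by simp
  qed
  then show ?case
    by (auto simp only: shuffle_sum.simps intro!: linear_on_plus linear_on_signed assms(1))
qed

text \<open>Once the recursion has consumed the equal arguments \<open>(x, u)\<close> at positions \<open>i\<close> and \<open>i + 1\<close>, four
  terms remain. Those with \<open>u, u\<close> or \<open>x, x\<close> vanish. The two mixed ones evaluate the same sum at
  \<open>u # us\<close> and \<open>x # xs\<close>, with signs differing by the one inversion between \<open>x\<close> and \<open>u\<close>.\<close>

lemma shuffle_sum_adjacent_eq:
  assumes F: "bi_alternating_family t V s g r W N F"
    and "Suc i < n" "w i = w (Suc i)"
    and "\<And>i. i < n \<Longrightarrow> w i \<in> g \<times> V" "set us \<subseteq> V" "set xs \<subseteq> g" "n + length us + length xs = N"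
  shows "shuffle_sum F w n us xs = 0"
  using assms(2-)
proof (induction n arbitrary: us xs)
  case 0
  then show ?case by simp
next
  case (Suc n)
  have wn: "fst (w n) \<in> g" "snd (w n) \<in> V"
    using Suc.prems(3)[of n] by (auto simp: mem_Times_iff)
  show ?case
  proof (cases "Suc i < n")
    case True
    have "shuffle_sum F w n (snd (w n) # us) xs = 0"
      by (rule Suc.IH) (use Suc.prems wn True in auto)
    moreover have "shuffle_sum F w n us (fst (w n) # xs) = 0"
      by (rule Suc.IH) (use Suc.prems wn True in auto)
    ultimately show ?thesis by simp
  next
    case False
    then have n: "n = Suc i" using Suc.prems(1) by simp
    obtain x u where xu: "w i = (x, u)" "w (Suc i) = (x, u)"
      using Suc.prems(2) by (metis prod.exhaust)
    have mem: "x \<in> g" "u \<in> V" using wn xu n by auto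
    have "shuffle_sum F w i (u # u # us) xs = 0"
      by (rule shuffle_sum_not_distinct[OF F]) (use Suc.prems mem n in auto)
    moreover have "shuffle_sum F w i us (x # x # xs) = 0"
      by (rule shuffle_sum_not_distinct[OF F]) (use Suc.prems mem n in auto)
    ultimately show ?thesis
      using xu by (simp add: n signed_Suc)
  qed
qed

lemma shuffle_sum_alternating_map:
  assumes r: "module r" "module.subspace r W" and s: "module s" "module.subspace s g"
    and t: "module t" "module.subspace t V"
    and F: "bi_alternating_family t V s g r W n F"
  shows "alternating_map (module_prod.scale s t) (g \<times> V) r W n (\<lambda>ws. shuffle_sum F ((!) ws) n [] [])"
proof -
  interpret s: module s by fact
  interpret t: module t by fact
  interpret module_prod s t ..
  have nth: "ws ! i \<in> g \<times> V" if "ws \<in> nlists n (g \<times> V)" "i < n" for ws i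
    using that by (rule nlistsE_nth_in)
  have lin: "multilinear_on scale r (g \<times> V) n (\<lambda>ws. shuffle_sum F ((!) ws) n [] [])"
    unfolding multilinear_on_def
  proof (intro ballI allI impI)
    fix ws i assume ws: "ws \<in> nlists n (g \<times> V)" and i: "i < n"
    have "shuffle_sum F ((!) (ws[i := y])) n [] [] = shuffle_sum F (((!) ws)(i := y)) n [] []" for y
      by (rule shuffle_sum_cong) (use ws i in \<open>auto simp: nth_list_update\<close>)
    then show "linear_on scale r (g \<times> V) (\<lambda>y. shuffle_sum F ((!) (ws[i := y])) n [] [])"
      using shuffle_sum_linear[OF r(1) module_prod_axioms F i nth[OF ws]] by simp
  qed
  have adj: "shuffle_sum F ((!) (as @ y # y # bs)) n [] [] = 0"
    if "set as \<subseteq> g \<times> V" "y \<in> g \<times> V" "set bs \<subseteq> g \<times> V" "Suc (Suc (length as + length bs)) = n" for as y bs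
  proof (rule shuffle_sum_adjacent_eq[OF F, of "length as"])
    have "as @ y # y # bs \<in> nlists n (g \<times> V)" unfolding nlists_def using that by simp
    from nth[OF this] show "\<And>i. i < n \<Longrightarrow> (as @ y # y # bs) ! i \<in> g \<times> V" .
  qed (use that in \<open>auto simp: nth_append\<close>)
  show ?thesis
    unfolding alternating_map_def
  proof (intro conjI ballI)
    show "shuffle_sum F ((!) ws) n [] [] \<in> W" if "ws \<in> nlists n (g \<times> V)" for ws
      by (rule shuffle_sum_closed[OF r F]) (use nth[OF that] in auto)
    show "alternating_on (g \<times> V) n (\<lambda>ws. shuffle_sum F ((!) ws) n [] [])"
      by (rule alternating_on_adjacentI[OF lin p.module_axioms subspace_Times[OF s(2) t(2)] adj])
  qed (rule lin)
qed


section \<open>Full extending data\<close>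

lemma alternating_map_Pair:
  assumes "module_prod a b" "alternating_map s S a A m f" "alternating_map s S b B m h"
  shows "alternating_map s S (module_prod.scale a b) (A \<times> B) m (\<lambda>xs. (f xs, h xs))"
  using assms unfolding alternating_map_def multilinear_on_def alternating_on_def linear_on_def
  by (simp add: module_prod.scale_def zero_prod_def)

lemma alternating_map_zero:
  assumes "module t" "module.subspace t V"
  shows "alternating_map s S t V m (\<lambda>_. 0)"
proof -
  interpret module t by fact
  show ?thesis
    using assms(2) unfolding alternating_map_def multilinear_on_def alternating_on_def linear_on_def
    by (simp add: subspace_0)
qed

text \<open>With no arguments, linearity and alternation are vacuous: a \<open>0\<close>-ary map is an element of the
  target.\<close>

lemma alternating_map_0_iff: "alternating_map s S t T 0 f \<longleftrightarrow> f [] \<in> T"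
  by (simp add: alternating_map_def multilinear_on_def alternating_on_def)

lemma bi_alternating_map_cong:
  assumes "\<And>us xs. length us = k \<Longrightarrow> f us xs = h us xs"
  shows "bi_alternating_map t V k s S m r W f \<longleftrightarrow> bi_alternating_map t V k s S m r W h"
proof -
  have "f us = h us" if "us \<in> nlists k V" for us
    using assms that by auto
  moreover have "alternating_map t V r W k (\<lambda>us. f us xs) = alternating_map t V r W k (\<lambda>us. h us xs)" for xs
    using assms unfolding alternating_map_def multilinear_on_def alternating_on_def linear_on_def
    by simp
  ultimately show ?thesis unfolding bi_alternating_map_def by simp
qed

lemma datum_value_family:
  assumes "module s" "module t" and g: "alternating_map s g s g n br"
    and datum: "full_extending_datum s t n g V \<Gamma>g \<Gamma>V"
  shows "bi_alternating_family t V s g (module_prod.scale s t) (g \<times> V) n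
    (\<lambda>us. datum_value br \<Gamma>g \<Gamma>V (length us) us)"
  unfolding bi_alternating_family_def
proof (intro allI impI)
  interpret s: module s by fact
  interpret t: module t by fact
  interpret module_prod s t ..
  have sub: "s.subspace g" "t.subspace V"
    using datum unfolding full_extending_datum_def by auto
  fix k m assume n: "k + m = n"
  show "bi_alternating_map t V k s g m scale (g \<times> V) (\<lambda>us. datum_value br \<Gamma>g \<Gamma>V (length us) us)"
  proof (cases "k = 0")
    case True
    have br: "alternating_map s g scale (g \<times> V) m (\<lambda>xs. (br xs, 0))"
      using True n g by (intro alternating_map_Pair module_prod_axioms alternating_map_zero sub t.module_axioms) auto
    then have "bi_alternating_map t V 0 s g m scale (g \<times> V) (\<lambda>us xs. (br xs, 0))"
      unfolding bi_alternating_map_def alternating_map_0_iff by (simp add: alternating_map_def)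
    then show ?thesis
      unfolding True by (rule bi_alternating_map_cong[THEN iffD1, rotated]) (simp add: datum_value_def)
  next
    case False
    have m: "m = n - k" "k \<in> {1..n}" using n False by auto
    have \<Gamma>g: "bi_alternating_map t V k s g m s g (\<Gamma>g k)"
      and \<Gamma>V: "bi_alternating_map t V k s g m t V (\<Gamma>V k)"
      using datum m unfolding full_extending_datum_def by auto
    have "bi_alternating_map t V k s g m scale (g \<times> V) (\<lambda>us xs. (\<Gamma>g k us xs, \<Gamma>V k us xs))"
      using \<Gamma>g \<Gamma>V unfolding bi_alternating_map_def
      by (auto intro!: alternating_map_Pair module_prod_axioms)
    then show ?thesis
      by (rule bi_alternating_map_cong[THEN iffD1, rotated]) (simp add: datum_value_def False)
  qed
qed

lemma full_bracket_alternating_map: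
  assumes s: "vector_space s" and t: "vector_space t" and g: "alternating_map s g s g n br"
    and datum: "full_extending_datum s t n g V \<Gamma>g \<Gamma>V"
  shows "alternating_map (module_prod.scale s t) (g \<times> V) (module_prod.scale s t) (g \<times> V) n
    (full_bracket s t n br \<Gamma>g \<Gamma>V)"
proof -
  interpret s: vector_space s by fact
  interpret t: vector_space t by fact
  interpret vector_space_prod s t ..
  have sub: "s.subspace g" "t.subspace V"
    using datum unfolding full_extending_datum_def by auto
  have "full_bracket s t n br \<Gamma>g \<Gamma>V =
      (\<lambda>ws. shuffle_sum (\<lambda>us. datum_value br \<Gamma>g \<Gamma>V (length us) us) ((!) ws) n [] [])"
    by (rule ext) (rule full_bracket_eq_shuffle_sum[OF s t])
  then show ?thesis
    using shuffle_sum_alternating_map[OF p.module_axioms subspace_Times[OF sub] s.module_axioms sub(1)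
        t.module_axioms sub(2) datum_value_family[OF s.module_axioms t.module_axioms g datum]]
    by simp
qed

text \<open>A term with a zero among its \<open>V\<close>-arguments vanishes by linearity, which leaves only the term
  without \<open>V\<close>-arguments.\<close>

lemma shuffle_sum_snd_eq_0:
  assumes "module r" "module t" "0 \<in> V" and F: "bi_alternating_family t V s g r W N F"
    and "\<And>i. i < n \<Longrightarrow> fst (w i) \<in> g" "\<And>i. i < n \<Longrightarrow> snd (w i) = 0"
    and "set xs \<subseteq> g" "n + length xs = N"
  shows "shuffle_sum F w n [] xs = F [] (map (\<lambda>i. fst (w i)) [0..<n] @ xs)"
  using assms(5-)
proof (induction n arbitrary: xs)
  case 0
  then show ?case by simp
next
  case (Suc n)
  interpret r: module r by fact
  interpret t: module t by fact
  have "linear_on t r V (\<lambda>y. shuffle_sum F w n ([] @ y # []) xs)"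
    by (rule shuffle_sum_linear_left[OF assms(1) F])
      (use Suc.prems assms(3) in \<open>auto simp: mem_Times_iff\<close>)
  from linear_onD(2)[OF this assms(3), of 0]
  have "shuffle_sum F w n [0] xs = 0" by simp
  moreover have "shuffle_sum F w n [] (fst (w n) # xs)
      = F [] (map (\<lambda>i. fst (w i)) [0..<n] @ fst (w n) # xs)"
    by (rule Suc.IH) (use Suc.prems in auto)
  ultimately show ?case using Suc.prems by simp
qed

lemma full_bracket_restrict:
  fixes t :: "'k::field \<Rightarrow> 'c::ab_group_add \<Rightarrow> 'c"
  assumes s: "vector_space s" and t: "vector_space t" and g: "alternating_map s g s g n br"
    and datum: "full_extending_datum s t n g V \<Gamma>g \<Gamma>V" and xs: "xs \<in> nlists n g"
  shows "full_bracket s t n br \<Gamma>g \<Gamma>V (map (\<lambda>x. (x, 0)) xs) = (br xs, 0)"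
proof -
  interpret s: vector_space s by fact
  interpret t: vector_space t by fact
  interpret vector_space_prod s t ..
  have len: "length xs = n" using xs by simp
  have V0: "0 \<in> V" using datum t.subspace_0 unfolding full_extending_datum_def by auto
  have nth: "xs ! i \<in> g" if "i < n" for i using xs that by (rule nlistsE_nth_in)
  define F where "F = (\<lambda>us. datum_value br \<Gamma>g \<Gamma>V (length us) us)"
  have "full_bracket s t n br \<Gamma>g \<Gamma>V (map (\<lambda>x. (x, 0)) xs)
      = F [] (map (\<lambda>i. fst ((map (\<lambda>x. (x, 0 :: 'c)) xs) ! i)) [0..<n] @ [])"
    unfolding full_bracket_eq_shuffle_sum[OF s t] F_def[symmetric]
    by (rule shuffle_sum_snd_eq_0[OF p.module_axioms t.module_axioms V0
        datum_value_family[OF s.module_axioms t.module_axioms g datum, folded F_def]])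
      (use nth len in auto)
  also have "map (\<lambda>i. fst ((map (\<lambda>x. (x, 0 :: 'c)) xs) ! i)) [0..<n] = xs"
    using len by (intro nth_equalityI) auto
  finally show ?thesis by (simp add: F_def datum_value_def)
qed
lemma full_extending_structure_n_lie_algebra:
  assumes s: "vector_space s" and t: "vector_space t" and g: "n_lie_algebra s n g br"
    and \<Gamma>: "full_extending_structure s t n g br V \<Gamma>g \<Gamma>V"
  shows "n_lie_algebra (module_prod.scale s t) n (g \<times> V) (full_bracket s t n br \<Gamma>g \<Gamma>V)"
proof -
  interpret s: vector_space s by fact
  interpret t: vector_space t by fact
  interpret vector_space_prod s t ..
  have datum: "full_extending_datum s t n g V \<Gamma>g \<Gamma>V"
    and filippov: "filippov_identity (g \<times> V) n (full_bracket s t n br \<Gamma>g \<Gamma>V)"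
    using \<Gamma> unfolding full_extending_structure_def by auto
  have "p.subspace (g \<times> V)"
    using datum unfolding full_extending_datum_def by (auto intro: subspace_Times)
  then show ?thesis
    using full_bracket_alternating_map[OF s t _ datum] filippov g unfolding n_lie_algebra_def by auto
qed


section \<open>Expanding an alternating map along a decomposition of its arguments\<close>

lemma alternating_map_swap:
  assumes s: "module s" "module.subspace s S" and f: "alternating_map s S r W N f"
    and "set as \<subseteq> S" "x \<in> S" "y \<in> S" "set bs \<subseteq> S" "Suc (Suc (length as + length bs)) = N"
  shows "f (as @ x # y # bs) = - f (as @ y # x # bs)"
proof -
  have lin: "multilinear_on s r S N f" and alt: "alternating_on S N f"
    using f unfolding alternating_map_def by auto
  have "f (as @ y # y # bs) = 0"
    if "set as \<subseteq> S" "y \<in> S" "set bs \<subseteq> S" "Suc (Suc (length as + length bs)) = N" for as y bs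
  proof -
    have "as @ y # y # bs \<in> nlists N S" unfolding nlists_def using that by simp
    then show ?thesis by (rule alt[unfolded alternating_on_def, rule_format]) simp
  qed
  from adjacent_swap[OF lin s this] assms(4-) show ?thesis by blast
qed

lemma alternating_map_move:
  assumes s: "module s" "module.subspace s S" and f: "alternating_map s S r W N f"
    and "set as \<subseteq> S" "x \<in> S" "set us \<subseteq> S" "set bs \<subseteq> S"
    and "Suc (length as + length us + length bs) = N"
  shows "f (as @ x # us @ bs) = signed (length us) (f (as @ us @ x # bs))"
  using assms(4-)
proof (induction us arbitrary: as)
  case Nil
  then show ?case by simp
next
  case (Cons u us)
  have "f (as @ x # u # (us @ bs)) = - f (as @ u # x # (us @ bs))"
    by (rule alternating_map_swap[OF s f]) (use Cons.prems in auto)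
  moreover have "f ((as @ [u]) @ x # us @ bs) = signed (length us) (f ((as @ [u]) @ us @ x # bs))"
    by (rule Cons.IH) (use Cons.prems in auto)
  ultimately show ?case by (simp add: signed_Suc)
qed

text \<open>The last unexpanded argument is split as \<open>x + u\<close>. The term with \<open>u\<close> already has the required shape;
  in the term with \<open>x\<close>, moving \<open>x\<close> to the right past \<open>us\<close> produces the sign of the recursion.\<close>

lemma alternating_map_expand:
  assumes s: "module s" "module.subspace s E" and f: "alternating_map s E r W N f"
    and sub: "g \<subseteq> E" "V \<subseteq> E"
    and "\<And>i. i < n \<Longrightarrow> w i \<in> g \<times> V" "set us \<subseteq> V" "set xs \<subseteq> g" "n + length us + length xs = N"
  shows "f (map (\<lambda>i. fst (w i) + snd (w i)) [0..<n] @ us @ xs)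
    = shuffle_sum (\<lambda>us xs. f (us @ xs)) w n us xs"
  using assms(6-)
proof (induction n arbitrary: us xs)
  case 0
  then show ?case by simp
next
  case (Suc n)
  obtain x u where w: "w n = (x, u)" by (cases "w n")
  have xu: "x \<in> g" "u \<in> V" "x \<in> E" "u \<in> E"
    using Suc.prems(1)[of n] w sub by auto
  have E: "set us \<subseteq> E" "set xs \<subseteq> E" using Suc.prems sub by auto
  define as where "as = map (\<lambda>i. fst (w i) + snd (w i)) [0..<n]"
  have "fst (w i) + snd (w i) \<in> E" if "i < n" for i
    using Suc.prems(1)[of i] that sub s by (auto simp: mem_Times_iff intro!: module.subspace_add)
  then have as: "set as \<subseteq> E" "length as = n" unfolding as_def by auto
  have lin: "linear_on s r E (\<lambda>y. f (as @ y # us @ xs))"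
    using f as E Suc.prems(4) unfolding alternating_map_def multilinear_on_iff by simp
  have "f (as @ (x + u) # us @ xs) = f (as @ x # us @ xs) + f (as @ u # us @ xs)"
    by (rule linear_onD(1)[OF lin xu(3,4)])
  also have "f (as @ x # us @ xs) = signed (length us) (f (as @ us @ x # xs))"
    by (rule alternating_map_move[OF s f]) (use as xu E Suc.prems in auto)
  also have "f (as @ us @ x # xs) = shuffle_sum (\<lambda>us xs. f (us @ xs)) w n us (x # xs)"
    unfolding as_def by (rule Suc.IH) (use Suc.prems xu in auto)
  also have "f (as @ u # us @ xs) = f (as @ (u # us) @ xs)" by simp
  also have "\<dots> = shuffle_sum (\<lambda>us xs. f (us @ xs)) w n (u # us) xs"
    unfolding as_def by (rule Suc.IH) (use Suc.prems xu in auto)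
  finally show ?case by (simp add: w as_def add.commute)
qed

lemma alternating_map_compose:
  assumes t: "module t" "module.subspace t T" and r: "module r"
    and f: "alternating_map s S t T m f" and h: "linear_on t r T h" "h ` T \<subseteq> R"
  shows "alternating_map s S r R m (\<lambda>xs. h (f xs))"
proof -
  interpret t: module t by fact
  interpret r: module r by fact
  have h0: "h 0 = 0"
    using linear_onD(2)[OF h(1) t.subspace_0[OF t(2)], of 0] by simp
  have fT: "f xs \<in> T" if "xs \<in> nlists m S" for xs
    using f that unfolding alternating_map_def by blast
  have "multilinear_on s r S m (\<lambda>xs. h (f xs))"
    unfolding multilinear_on_def
  proof (intro ballI allI impI)
    fix xs i assume xs: "xs \<in> nlists m S" and i: "i < m"
    have "linear_on s t S (\<lambda>y. f (xs[i := y]))"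
      using f xs i unfolding alternating_map_def multilinear_on_def by blast
    moreover have "(\<lambda>y. f (xs[i := y])) ` S \<subseteq> T"
      using fT nlists_update_in_list[OF xs] by blast
    ultimately show "linear_on s r S (\<lambda>y. h (f (xs[i := y])))"
      using linear_on_compose[OF _ h(1)] by blast
  qed
  moreover have "alternating_on S m (\<lambda>xs. h (f xs))"
    using f unfolding alternating_map_def alternating_on_def by (simp add: h0)
  ultimately show ?thesis using fT h(2) unfolding alternating_map_def by blast
qed

lemma alternating_map_append_bi_alternating:
  assumes f: "alternating_map s E r W N f" and sub: "V \<subseteq> E" "g \<subseteq> E" and N: "k + m = N"
  shows "bi_alternating_map s V k s g m r W (\<lambda>us xs. f (us @ xs))"
proof -
  have mem: "us @ xs \<in> nlists N E" if "us \<in> nlists k V" "xs \<in> nlists m g" for us xs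
    using that sub N unfolding nlists_def by auto
  have closed: "f (us @ xs) \<in> W" if "us \<in> nlists k V" "xs \<in> nlists m g" for us xs
    using f mem[OF that] unfolding alternating_map_def by simp
  have alt: "f (us @ xs) = 0"
    if "us \<in> nlists k V" "xs \<in> nlists m g" "\<not> distinct us \<or> \<not> distinct xs" for us xs
  proof -
    have "\<not> distinct (us @ xs)" using that(3) by auto
    then show ?thesis
      using f mem[OF that(1,2)] unfolding alternating_map_def alternating_on_def by simp
  qed
  have lin: "linear_on s r S (\<lambda>y. f (as @ y # bs))"
    if "set as \<subseteq> E" "set bs \<subseteq> E" "Suc (length as + length bs) = N" "S \<subseteq> E" for as bs S
  proof -
    have "linear_on s r E (\<lambda>y. f (as @ y # bs))"
      using f that unfolding alternating_map_def multilinear_on_iff by blast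
    then show ?thesis using that(4) unfolding linear_on_def by blast
  qed
  have "multilinear_on s r g m (\<lambda>xs. f (us @ xs))" if us: "us \<in> nlists k V" for us
    unfolding multilinear_on_iff
  proof (intro allI impI)
    fix as bs assume S: "set as \<subseteq> g" "set bs \<subseteq> g" and m: "Suc (length as + length bs) = m"
    have "set (us @ as) \<subseteq> E" "set bs \<subseteq> E" "Suc (length (us @ as) + length bs) = N"
      using S m us sub N unfolding nlists_def by auto
    from lin[OF this sub(2)] show "linear_on s r g (\<lambda>y. f (us @ as @ y # bs))" by simp
  qed
  moreover have "multilinear_on s r V k (\<lambda>us. f (us @ xs))" if xs: "xs \<in> nlists m g" for xs
    unfolding multilinear_on_iff
  proof (intro allI impI)
    fix as bs assume S: "set as \<subseteq> V" "set bs \<subseteq> V" and k: "Suc (length as + length bs) = k"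
    have "set as \<subseteq> E" "set (bs @ xs) \<subseteq> E" "Suc (length as + length (bs @ xs)) = N"
      using S k xs sub N unfolding nlists_def by auto
    from lin[OF this sub(1)] show "linear_on s r V (\<lambda>y. f ((as @ y # bs) @ xs))" by simp
  qed
  ultimately show ?thesis
    using closed alt unfolding bi_alternating_map_def alternating_map_def alternating_on_def by blast
qed


section \<open>The datum of a split extension\<close>

lemma coset_eq_iff:
  assumes "module s" "module.subspace s S"
  shows "a +o S = b +o S \<longleftrightarrow> a - b \<in> S"
proof -
  interpret module s by fact
  show ?thesis
  proof
    assume "a +o S = b +o S"
    moreover have "a \<in> a +o S" using subspace_0[OF assms(2)] by (auto simp: elt_set_plus_def)
    ultimately show "a - b \<in> S" by (auto simp: elt_set_plus_def)
  next
    have le: "a +o S \<subseteq> b +o S" if "a - b \<in> S" for a b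
    proof
      fix x assume "x \<in> a +o S"
      then obtain y where "y \<in> S" "x = b + ((a - b) + y)" by (auto simp: elt_set_plus_def)
      then show "x \<in> b +o S"
        using subspace_add[OF assms(2) that] unfolding elt_set_plus_def by blast
    qed
    assume "a - b \<in> S"
    moreover from this have "b - a \<in> S" using subspace_neg[OF assms(2)] by fastforce
    ultimately show "a +o S = b +o S" using le by blast
  qed
qed

text \<open>An extension of \<open>g\<close> together with the projection that splits it linearly. The map \<open>\<Psi>\<close> is the
  inverse of \<open>\<Phi>\<close>, with first component \<open>p\<close> and second component \<open>q\<close>.\<close>

locale split_extension = vector_space s
  for s :: "'k::field \<Rightarrow> 'a::ab_group_add \<Rightarrow> 'a" +
  fixes n :: nat and g :: "'a set" and br :: "'a list \<Rightarrow> 'a"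
    and E :: "'a set" and brE :: "'a list \<Rightarrow> 'a" and p :: "'a \<Rightarrow> 'a"
  assumes n: "n \<ge> 1"
    and g_lie: "n_lie_algebra s n g br"
    and g_sub: "g \<subseteq> E"
    and E_lie: "n_lie_algebra s n E brE"
    and restrict: "\<And>xs. xs \<in> nlists n g \<Longrightarrow> brE xs = br xs"
    and p_linear: "linear_on s s E p"
    and p_range: "p ` E \<subseteq> g"
    and p_id: "\<And>x. x \<in> g \<Longrightarrow> p x = x"
begin

abbreviation V :: "'a set" where "V \<equiv> {e \<in> E. p e = 0}"

abbreviation \<Gamma>g :: "nat \<Rightarrow> 'a list \<Rightarrow> 'a list \<Rightarrow> 'a"
  where "\<Gamma>g \<equiv> \<lambda>k us xs. p (brE (us @ xs))"

abbreviation \<Gamma>V :: "nat \<Rightarrow> 'a list \<Rightarrow> 'a list \<Rightarrow> 'a"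
  where "\<Gamma>V \<equiv> \<lambda>k us xs. brE (us @ xs) - p (brE (us @ xs))"

abbreviation \<Phi> :: "'a \<times> 'a \<Rightarrow> 'a" where "\<Phi> \<equiv> \<lambda>(x, u). x + u"

abbreviation \<Psi> :: "'a \<Rightarrow> 'a \<times> 'a" where "\<Psi> \<equiv> \<lambda>e. (p e, e - p e)"

sublocale vector_space_prod s s ..

lemma subspace_g: "subspace g" and subspace_E: "subspace E"
  using g_lie E_lie unfolding n_lie_algebra_def by auto

lemma brE_alternating: "alternating_map s E s E n brE"
  using E_lie unfolding n_lie_algebra_def by auto

lemma p_add: "e \<in> E \<Longrightarrow> e' \<in> E \<Longrightarrow> p (e + e') = p e + p e'"
  and p_scale: "e \<in> E \<Longrightarrow> p (s c e) = s c (p e)"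
  using p_linear unfolding linear_on_def by auto

lemma p_zero: "p 0 = 0"
  using p_id subspace_0[OF subspace_g] by blast

lemma p_diff: "e \<in> E \<Longrightarrow> e' \<in> E \<Longrightarrow> p (e - e') = p e - p e'"
  using p_add[of "e - e'" e'] subspace_diff[OF subspace_E] by (simp add: eq_diff_eq)

lemma p_in: "e \<in> E \<Longrightarrow> p e \<in> g" "e \<in> E \<Longrightarrow> p e \<in> E"
  using p_range g_sub by auto

lemma q_in: "e \<in> E \<Longrightarrow> e - p e \<in> V"
  using p_in p_id p_diff subspace_diff[OF subspace_E] by simp

lemma subspace_V: "subspace V"
  unfolding subspace_def
  using subspace_E p_add p_scale p_zero by (auto simp: subspace_def)

lemma q_linear: "linear_on s s E (\<lambda>e. e - p e)"
  unfolding linear_on_def using p_add p_scale by (simp add: scale_right_diff_distrib)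

lemma \<Psi>_linear: "linear_on s scale E \<Psi>"
  using p_linear q_linear unfolding linear_on_def scale_def by simp

lemma \<Psi>_in: "e \<in> E \<Longrightarrow> \<Psi> e \<in> g \<times> V"
  using p_in q_in by simp

lemma \<Phi>_in: "w \<in> g \<times> V \<Longrightarrow> \<Phi> w \<in> E"
  using g_sub subspace_add[OF subspace_E] by auto

lemma \<Phi>_\<Psi>: "\<Phi> (\<Psi> e) = e"
  by simp

lemma \<Psi>_\<Phi>: "w \<in> g \<times> V \<Longrightarrow> \<Psi> (\<Phi> w) = w"
  using g_sub by (auto simp: p_add p_id)

lemma datum: "full_extending_datum s s n g V \<Gamma>g \<Gamma>V"
  unfolding full_extending_datum_def
proof (intro conjI ballI)
  fix k assume k: "k \<in> {1..n}"
  have pbr: "alternating_map s E s g n (\<lambda>xs. p (brE xs))"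
    by (rule alternating_map_compose[OF module_axioms subspace_E module_axioms brE_alternating p_linear p_range])
  have qbr: "alternating_map s E s V n (\<lambda>xs. brE xs - p (brE xs))"
    by (rule alternating_map_compose[OF module_axioms subspace_E module_axioms brE_alternating q_linear])
      (use q_in in blast)
  show "bi_alternating_map s V k s g (n - k) s g (\<Gamma>g k)"
    by (rule alternating_map_append_bi_alternating[OF pbr]) (use g_sub k in auto)
  show "bi_alternating_map s V k s g (n - k) s V (\<Gamma>V k)"
    by (rule alternating_map_append_bi_alternating[OF qbr]) (use g_sub k in auto)
qed (rule subspace_g subspace_V)+

text \<open>The map to expand is \<open>\<Psi>\<close> after \<open>brE\<close>, which is alternating with values in \<open>g \<times> V\<close>. Its values on
  \<open>us @ xs\<close> are those of the datum by definition, except for empty \<open>us\<close>: there the datum has \<open>(br xs, 0)\<close>,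
  and this is where \<open>brE\<close> extending \<open>br\<close>, and \<open>p\<close> fixing \<open>g\<close>, are used.\<close>

lemma full_bracket_eq:
  assumes ws: "ws \<in> nlists n (g \<times> V)"
  shows "full_bracket s s n br \<Gamma>g \<Gamma>V ws = \<Psi> (brE (map \<Phi> ws))"
proof -
  have nth: "ws ! i \<in> g \<times> V" if "i < n" for i
    using ws that by (rule nlistsE_nth_in)
  have len: "length ws = n" using ws by simp
  have br: "alternating_map s E scale (g \<times> V) n (\<lambda>xs. \<Psi> (brE xs))"
    by (rule alternating_map_compose[OF module_axioms subspace_E p.module_axioms brE_alternating \<Psi>_linear])
      (use \<Psi>_in in blast)
  have "map \<Phi> ws = map (\<lambda>i. fst (ws ! i) + snd (ws ! i)) [0..<n] @ [] @ []"
    using len by (intro nth_equalityI) (auto simp: case_prod_beta)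
  then have "\<Psi> (brE (map \<Phi> ws))
      = \<Psi> (brE (map (\<lambda>i. fst (ws ! i) + snd (ws ! i)) [0..<n] @ [] @ []))"
    by (simp only:)
  also have "\<dots> = shuffle_sum (\<lambda>us xs. \<Psi> (brE (us @ xs))) ((!) ws) n [] []"
    by (rule alternating_map_expand[OF module_axioms subspace_E br g_sub, of V]) (use nth in auto)
  also have "\<dots> = shuffle_sum (\<lambda>us. datum_value br \<Gamma>g \<Gamma>V (length us) us) ((!) ws) n [] []"
  proof (rule shuffle_sum_cong_value)
    fix us xs assume "set us \<subseteq> V" and xs: "set xs \<subseteq> g" and N: "length us + length xs = n"
    show "\<Psi> (brE (us @ xs)) = datum_value br \<Gamma>g \<Gamma>V (length us) us xs"
    proof (cases "us = []")
      case True
      have "xs \<in> nlists n g" unfolding nlists_def using xs N True by simp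
      moreover from this have "br xs \<in> g"
        using g_lie unfolding n_lie_algebra_def alternating_map_def by blast
      ultimately show ?thesis using True by (simp add: datum_value_def restrict p_id)
    qed (simp add: datum_value_def)
  qed (use nth in auto)
  also have "\<dots> = full_bracket s s n br \<Gamma>g \<Gamma>V ws"
    by (rule full_bracket_eq_shuffle_sum[symmetric]) (rule vector_space_axioms)+
  finally show ?thesis by simp
qed

lemma brE_closed: "xs \<in> nlists n E \<Longrightarrow> brE xs \<in> E"
  using brE_alternating unfolding alternating_map_def by blast

lemma map_\<Phi>_nlists: "ws \<in> nlists m (g \<times> V) \<Longrightarrow> map \<Phi> ws \<in> nlists m E"
  unfolding nlists_def using \<Phi>_in by (auto simp del: case_prod_conv)

text \<open>By \<open>full_bracket_eq\<close>, applying \<open>\<Phi>\<close> turns nested brackets of the datum into nested brackets of \<open>E\<close>.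
  So the identity is \<open>\<Psi>\<close> applied to the one in \<open>E\<close>.\<close>

lemma full_bracket_filippov: "filippov_identity (g \<times> V) n (full_bracket s s n br \<Gamma>g \<Gamma>V)"
  unfolding filippov_identity_def
proof (intro ballI)
  let ?b = "full_bracket s s n br \<Gamma>g \<Gamma>V"
  fix zs ws assume zs: "zs \<in> nlists (n - 1) (g \<times> V)" and ws: "ws \<in> nlists n (g \<times> V)"
  have snoc: "zs @ [w] \<in> nlists n (g \<times> V)" if "w \<in> g \<times> V" for w
    using zs that n unfolding nlists_def by simp
  have Zs: "map \<Phi> zs \<in> nlists (n - 1) E" and Ws: "map \<Phi> ws \<in> nlists n E"
    using zs ws map_\<Phi>_nlists by simp_all
  have closed: "?b vs \<in> g \<times> V" if "vs \<in> nlists n (g \<times> V)" for vs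
    unfolding full_bracket_eq[OF that] by (rule \<Psi>_in brE_closed map_\<Phi>_nlists that)+
  have \<Phi>b: "\<Phi> (?b vs) = brE (map \<Phi> vs)" if "vs \<in> nlists n (g \<times> V)" for vs
    unfolding full_bracket_eq[OF that] by (rule \<Phi>_\<Psi>)
  define c where "c = (\<lambda>i. ?b (zs @ [ws ! i]))"
  have wi: "ws ! i \<in> g \<times> V" if "i < n" for i
    using ws that by (rule nlistsE_nth_in)
  have upd: "ws[i := c i] \<in> nlists n (g \<times> V)" if "i < n" for i
    unfolding c_def by (rule nlists_update_in_list[OF ws closed[OF snoc[OF wi[OF that]]]])
  have \<Phi>c: "\<Phi> (c i) = brE (map \<Phi> zs @ [map \<Phi> ws ! i])" if "i < n" for i
    unfolding c_def \<Phi>b[OF snoc[OF wi[OF that]]] using ws that by simp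
  have "?b (zs @ [?b ws]) = \<Psi> (brE (map \<Phi> (zs @ [?b ws])))"
    by (rule full_bracket_eq[OF snoc[OF closed[OF ws]]])
  also have "map \<Phi> (zs @ [?b ws]) = map \<Phi> zs @ [brE (map \<Phi> ws)]"
    using \<Phi>b[OF ws] by simp
  also have "brE (map \<Phi> zs @ [brE (map \<Phi> ws)])
      = (\<Sum>i<n. brE ((map \<Phi> ws)[i := brE (map \<Phi> zs @ [map \<Phi> ws ! i])]))"
    using E_lie Zs Ws unfolding n_lie_algebra_def filippov_identity_def by blast
  also have "\<dots> = (\<Sum>i<n. brE (map \<Phi> (ws[i := c i])))"
    by (intro sum.cong refl) (simp add: map_update \<Phi>c del: case_prod_conv)
  also have "\<Psi> \<dots> = (\<Sum>i<n. \<Psi> (brE (map \<Phi> (ws[i := c i]))))"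
    by (rule linear_on_sum[OF module_axioms p.module_axioms subspace_E \<Psi>_linear])
      (use upd map_\<Phi>_nlists brE_closed in blast)
  also have "\<dots> = (\<Sum>i<n. ?b (ws[i := c i]))"
    by (intro sum.cong refl) (simp only: full_bracket_eq[OF upd] lessThan_iff)
  finally show "?b (zs @ [?b ws]) = (\<Sum>i<n. ?b (ws[i := ?b (zs @ [ws ! i])]))"
    unfolding c_def .
qed

lemma full_extending_structure: "full_extending_structure s s n g br V \<Gamma>g \<Gamma>V"
  unfolding full_extending_structure_def using datum full_bracket_filippov by blast

lemma \<Phi>_iso: "n_lie_iso scale s n (g \<times> V) (full_bracket s s n br \<Gamma>g \<Gamma>V) E brE \<Phi>"
  unfolding n_lie_iso_def
proof (intro conjI ballI)
  show "n_lie_algebra scale n (g \<times> V) (full_bracket s s n br \<Gamma>g \<Gamma>V)"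
    by (rule full_extending_structure_n_lie_algebra[OF vector_space_axioms vector_space_axioms
          g_lie full_extending_structure])
  show "linear_on scale s (g \<times> V) \<Phi>"
    by (auto simp: linear_on_def scale_def scale_right_distrib)
  show "bij_betw \<Phi> (g \<times> V) E"
    by (rule bij_betw_byWitness[where f' = \<Psi>]) (use \<Psi>_\<Phi> \<Phi>_\<Psi> \<Psi>_in \<Phi>_in in blast)+
  fix ws assume "ws \<in> nlists n (g \<times> V)"
  then show "\<Phi> (full_bracket s s n br \<Gamma>g \<Gamma>V ws) = brE (map \<Phi> ws)"
    by (simp only: full_bracket_eq \<Phi>_\<Psi>)
qed (rule E_lie)

lemma coset_prod:
  fixes u :: 'a
  assumes x: "x \<in> g"
  shows "(x, u) +o (g \<times> {0}) = g \<times> {u}"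
proof -
  have "\<exists>z\<in>g. y = x + z" if "y \<in> g" for y
    using subspace_diff[OF subspace_g that x] by (intro bexI[of _ "y - x"]) auto
  then show ?thesis
    using subspace_add[OF subspace_g x] by (auto simp: elt_set_plus_def)
qed

lemma bij_cosets_prod: "bij_betw (\<lambda>u. (0, u) +o (g \<times> {0})) V (coset_space (g \<times> V) (g \<times> {0}))"
proof -
  have g0: "0 \<in> g" by (rule subspace_0[OF subspace_g])
  have "coset_space (g \<times> V) (g \<times> {0}) = (\<lambda>u. g \<times> {u}) ` V"
    using g0 unfolding coset_space_def by (force simp: coset_prod)
  moreover have "inj_on (\<lambda>u. g \<times> {u}) V"
    using g0 by (auto simp: inj_on_def set_eq_iff)
  ultimately show ?thesis by (simp add: coset_prod[OF g0] bij_betw_def)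
qed

lemma coset_q: "e \<in> E \<Longrightarrow> (e - p e) +o g = e +o g"
  unfolding coset_eq_iff[OF module_axioms subspace_g]
  using p_in subspace_neg[OF subspace_g] by simp

lemma bij_cosets: "bij_betw (\<lambda>u. u +o g) V (coset_space E g)"
  unfolding bij_betw_def
proof
  show "inj_on (\<lambda>u. u +o g) V"
  proof (rule inj_onI)
    fix u v assume "u \<in> V" "v \<in> V" "u +o g = v +o g"
    \<comment> \<open>\<open>u - v\<close> lies in \<open>g \<inter> V\<close>, which is zero.\<close>
    then have "u - v \<in> g" "p (u - v) = 0"
      by (simp_all add: coset_eq_iff[OF module_axioms subspace_g] p_diff)
    then show "u = v" using p_id by force
  qed
  show "(\<lambda>u. u +o g) ` V = coset_space E g"
    unfolding coset_space_def
  proof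
    show "(\<lambda>e. e +o g) ` E \<subseteq> (\<lambda>u. u +o g) ` V"
      using coset_q q_in by blast
  qed blast
qed

lemma \<Phi>_coset: "x \<in> g \<Longrightarrow> u \<in> V \<Longrightarrow> \<Phi> ` ((x, u) +o (g \<times> {0})) = u +o g"
  unfolding coset_prod by (auto simp: elt_set_plus_def add.commute image_iff)

end


section \<open>Extending structures and full unified products\<close>

theorem theoremA4:
  fixes s :: "'k::field_char_0 \<Rightarrow> 'a::ab_group_add \<Rightarrow> 'a"
    and t :: "'k \<Rightarrow> 'v::ab_group_add \<Rightarrow> 'v"
    and n :: nat
    and g :: "'a set"
    and br :: "'a list \<Rightarrow> 'a"
  assumes "vector_space s" and "vector_space t"
    and "n \<ge> 2"
    and "n_lie_algebra s n g br"
  shows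
    "(\<forall>E brE p.
        module.subspace s E \<and> g \<subseteq> E \<and>
        n_lie_algebra s n E brE \<and> (\<forall>xs\<in>nlists n g. brE xs = br xs) \<and>
        linear_on s s E p \<and> p ` E \<subseteq> g \<and> (\<forall>x\<in>g. p x = x) \<longrightarrow>
        (let V = {e \<in> E. p e = 0};
             q = (\<lambda>e. e - p e);
             \<Gamma>g = (\<lambda>k us xs. p (brE (us @ xs)));
             \<Gamma>V = (\<lambda>k us xs. q (brE (us @ xs)));
             \<Phi> = (\<lambda>(x, u). x + u)
         in full_extending_structure s s n g br V \<Gamma>g \<Gamma>V \<and>
            n_lie_iso (module_prod.scale s s) s n
              (g \<times> V) (full_bracket s s n br \<Gamma>g \<Gamma>V) E brE \<Phi> \<and>
            (\<forall>x\<in>g. \<Phi> (x, 0) = x) \<and>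
            bij_betw (\<lambda>u. (0, u) +o (g \<times> {0})) V (coset_space (g \<times> V) (g \<times> {0})) \<and>
            bij_betw (\<lambda>u. u +o g) V (coset_space E g) \<and>
            (\<forall>e\<in>E. q e \<in> V \<and> q e +o g = e +o g) \<and>
            (\<forall>x\<in>g. \<forall>u\<in>V. \<Phi> ` ((x, u) +o (g \<times> {0})) = u +o g \<and> q (\<Phi> (x, u)) = u)))
     \<and>
     (\<forall>V \<Gamma>g \<Gamma>V.
        module.subspace t V \<and> full_extending_structure s t n g br V \<Gamma>g \<Gamma>V \<longrightarrow>
        n_lie_algebra (module_prod.scale s t) n (g \<times> V) (full_bracket s t n br \<Gamma>g \<Gamma>V) \<and>
        (\<forall>xs\<in>nlists n g.
          full_bracket s t n br \<Gamma>g \<Gamma>V (map (\<lambda>x. (x, 0)) xs) = (br xs, 0)))"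
proof -
  interpret s: vector_space s by fact
  have g: "alternating_map s g s g n br"
    using assms(4) unfolding n_lie_algebra_def by blast
  show ?thesis
  proof (intro conjI allI impI)
    fix E brE p
    assume hyp: "module.subspace s E \<and> g \<subseteq> E \<and>
        n_lie_algebra s n E brE \<and> (\<forall>xs\<in>nlists n g. brE xs = br xs) \<and>
        linear_on s s E p \<and> p ` E \<subseteq> g \<and> (\<forall>x\<in>g. p x = x)"
    interpret split_extension s n g br E brE p
      by unfold_locales (use hyp assms(3,4) in auto)
    have q\<Phi>: "\<Phi> (x, u) - p (\<Phi> (x, u)) = u" if "x \<in> g" "u \<in> V" for x u
      using \<Psi>_\<Phi>[of "(x, u)"] that by simp
    show "let V = {e \<in> E. p e = 0};
             q = (\<lambda>e. e - p e);
             \<Gamma>g = (\<lambda>k us xs. p (brE (us @ xs)));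
             \<Gamma>V = (\<lambda>k us xs. q (brE (us @ xs)));
             \<Phi> = (\<lambda>(x, u). x + u)
         in full_extending_structure s s n g br V \<Gamma>g \<Gamma>V \<and>
            n_lie_iso (module_prod.scale s s) s n
              (g \<times> V) (full_bracket s s n br \<Gamma>g \<Gamma>V) E brE \<Phi> \<and>
            (\<forall>x\<in>g. \<Phi> (x, 0) = x) \<and>
            bij_betw (\<lambda>u. (0, u) +o (g \<times> {0})) V (coset_space (g \<times> V) (g \<times> {0})) \<and>
            bij_betw (\<lambda>u. u +o g) V (coset_space E g) \<and>
            (\<forall>e\<in>E. q e \<in> V \<and> q e +o g = e +o g) \<and>
            (\<forall>x\<in>g. \<forall>u\<in>V. \<Phi> ` ((x, u) +o (g \<times> {0})) = u +o g \<and> q (\<Phi> (x, u)) = u)"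
      unfolding Let_def
      using full_extending_structure \<Phi>_iso bij_cosets_prod bij_cosets q_in coset_q \<Phi>_coset q\<Phi>
      by simp
  next
    fix V :: "'v set" and \<Gamma>g \<Gamma>V
    assume hyp: "module.subspace t V \<and> full_extending_structure s t n g br V \<Gamma>g \<Gamma>V"
    then show "n_lie_algebra (module_prod.scale s t) n (g \<times> V) (full_bracket s t n br \<Gamma>g \<Gamma>V)"
      using full_extending_structure_n_lie_algebra[OF assms(1,2,4)] by blast
    from hyp have "full_extending_datum s t n g V \<Gamma>g \<Gamma>V"
      unfolding full_extending_structure_def by blast
    then show "\<forall>xs\<in>nlists n g. full_bracket s t n br \<Gamma>g \<Gamma>V (map (\<lambda>x. (x, 0)) xs) = (br xs, 0)"
      using full_bracket_restrict[OF assms(1,2) g] by blast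
  qed
qed

end
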